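(* Let $d$ and $D$ be positive integers with $d<D$. If $G$ is an $n$-vertex graph with minimum degree $d$ and maximum degree $D$, then $$R(G)\ \ge\ \frac{\sqrt{dD}}{d+D}\,n.$$ Equality holds only when $G$ is an $n$-vertex $(d,D)$-biregular graph.
   Context: For a graph $G$ and a vertex $v$, $d(v)$ denotes the degree of $v$. The Randić index of $G$ is $R(G)=\sum_{uv\in E(G)}\frac{1}{\sqrt{d(u)d(v)}}$. A graph is $(a,b)$-biregular if it is bipartite and all vertices of one part have degree $a$ while all vertices of the other part have degree $b$. *)

theory Defs
  imports Complex_Main "Graph_Theory.Digraph"
begin

text \<open>
  A finite simple undirected graph is an instance of the locale \<^locale>\<open>graph\<close> of
  Graph_Theory: a finite symmetric digraph without loops and parallel arcs. Every undirected
  edge is thus represented by two opposite arcs, and the constants below are the undirected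
  notions for such a graph.
\<close>

definition uedges :: "('a, 'b) pre_digraph \<Rightarrow> 'a set set" where
  "uedges G = {{u, v} | u v. u \<rightarrow>\<^bsub>G\<^esub> v}"

text \<open>
  In a \<^locale>\<open>graph\<close> the arcs leaving a vertex correspond bijectively to the undirected edges
  incident with it; see \<open>vdegree_eq_card_uedges\<close> below.
\<close>

definition vdegree :: "('a, 'b) pre_digraph \<Rightarrow> 'a \<Rightarrow> nat" where
  "vdegree G v = out_degree G v"

definition min_degree :: "('a, 'b) pre_digraph \<Rightarrow> nat" where
  "min_degree G = Min (vdegree G ` verts G)"

definition max_degree :: "('a, 'b) pre_digraph \<Rightarrow> nat" where
  "max_degree G = Max (vdegree G ` verts G)"

text \<open>
  The sum ranges over undirected edges, so each edge counts once. For \<open>e = {u, v}\<close> with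
  \<open>u \<noteq> v\<close> the product over \<open>e\<close> is \<open>d(u) d(v)\<close>.
\<close>

definition randic_index :: "('a, 'b) pre_digraph \<Rightarrow> real" where
  "randic_index G = (\<Sum>e\<in>uedges G. 1 / sqrt (\<Prod>v\<in>e. real (vdegree G v)))"

definition bipartition :: "('a, 'b) pre_digraph \<Rightarrow> 'a set \<Rightarrow> 'a set \<Rightarrow> bool" where
  "bipartition G A B \<longleftrightarrow> A \<union> B = verts G \<and> A \<inter> B = {} \<and>
     (\<forall>u v. u \<rightarrow>\<^bsub>G\<^esub> v \<longrightarrow> u \<in> A \<and> v \<in> B \<or> u \<in> B \<and> v \<in> A)"

definition biregular :: "nat \<Rightarrow> nat \<Rightarrow> ('a, 'b) pre_digraph \<Rightarrow> bool" where
  "biregular a b G \<longleftrightarrow> (\<exists>A B. bipartition G A B \<and>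
     (\<forall>v\<in>A. vdegree G v = a) \<and> (\<forall>v\<in>B. vdegree G v = b))"

lemma (in graph) vdegree_eq_card_uedges:
  "vdegree G v = card {e \<in> uedges G. v \<in> e}"
proof -
  have "bij_betw (\<lambda>e. {tail G e, head G e}) (out_arcs G v) {e \<in> uedges G. v \<in> e}"
  proof (rule bij_betw_imageI)
    show "inj_on (\<lambda>e. {tail G e, head G e}) (out_arcs G v)"
      by (rule inj_onI, rule no_multi_arcs)
        (auto simp: arc_to_ends_def doubleton_eq_iff)
  next
    show "(\<lambda>e. {tail G e, head G e}) ` out_arcs G v = {e \<in> uedges G. v \<in> e}" (is "?L = ?R")
    proof
      show "?L \<subseteq> ?R"
        by (fastforce simp: uedges_def arcs_ends_conv)
      show "?R \<subseteq> ?L"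
      proof
        fix x assume "x \<in> ?R"
        then obtain u w where x: "x = {u, w}" and uw: "u \<rightarrow>\<^bsub>G\<^esub> w" and v: "v = u \<or> v = w"
          by (auto simp: uedges_def)
        from uw sym_arcs have "w \<rightarrow>\<^bsub>G\<^esub> u"
          by (rule arcs_ends_symmetric[rotated])
        with x uw v obtain w' where "x = {v, w'}" "v \<rightarrow>\<^bsub>G\<^esub> w'"
          by blast
        then show "x \<in> ?L"
          by (auto simp: arcs_ends_conv)
      qed
    qed
  qed
  then show ?thesis
    by (simp add: vdegree_def out_degree_def bij_betw_same_card)
qed

end

theory Submission
  imports Defs
begin

text \<open>
  Writing \<open>1 = (\<Sum>e \<ni> v. 1 / d(v))\<close> for every vertex and exchanging the sums gives
  \<open>n = (\<Sum>uv. 1 / d(u) + 1 / d(v))\<close>. The bound therefore follows from its version for a single edge,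
  which compares \<open>1 / sqrt (x y)\<close> with \<open>1 / x + 1 / y\<close> for \<open>x, y \<in> {d..D}\<close> and is an
  equality only for \<open>{x, y} = {d, D}\<close>.
\<close>

text \<open>The right side minus the left side factors as
  \<open>(b * p - a * q) * (b * q - a * p)\<close>, and neither factor is negative for
  \<open>p\<close> and \<open>q\<close> between \<open>a\<close> and \<open>b\<close>. In the case
  of equality one factor vanishes, which pushes \<open>p\<close> and \<open>q\<close> to opposite
  ends of the interval.\<close>

lemma weighted_sum_squares_le:
  fixes a b p q :: real
  assumes "0 < a" "a \<le> p" "p \<le> b" "a \<le> q" "q \<le> b"
  shows "a * b * (p\<^sup>2 + q\<^sup>2) \<le> (a\<^sup>2 + b\<^sup>2) * (p * q)"
    and "a * b * (p\<^sup>2 + q\<^sup>2) = (a\<^sup>2 + b\<^sup>2) * (p * q) \<Longrightarrow> p = a \<and> q = b \<or> p = b \<and> q = a"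
proof -
  have factor: "(a\<^sup>2 + b\<^sup>2) * (p * q) - a * b * (p\<^sup>2 + q\<^sup>2) = (b * p - a * q) * (b * q - a * p)"
    by (simp add: algebra_simps power2_eq_square)
  have nonneg: "a * s \<le> b * r" if "a \<le> r" "s \<le> b" "a \<le> s" for r s
    using mult_mono[of a r s b] that assms by (simp add: mult.commute)
  have extremal: "r = a \<and> s = b" if "a \<le> r" "s \<le> b" "a \<le> s" "b * r = a * s" for r s
  proof -
    \<comment> \<open>The chain \<open>s * a \<le> s * r \<le> b * r\<close> has equal ends by
      assumption, so both inequalities are equalities; cancelling \<open>s\<close> and
      \<open>r\<close> then gives the claim.\<close>
    have "s * a \<le> s * r" "s * r \<le> b * r"
      using that assms by (intro mult_left_mono mult_right_mono; linarith)+
    then have "s * a = s * r" "s * r = b * r"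
      using that(4) by (simp_all only: mult.commute[of s a])
    moreover have "s \<noteq> 0" "r \<noteq> 0"
      using that assms by linarith+
    ultimately show ?thesis by simp
  qed
  show "a * b * (p\<^sup>2 + q\<^sup>2) \<le> (a\<^sup>2 + b\<^sup>2) * (p * q)"
  proof -
    have "0 \<le> (b * p - a * q) * (b * q - a * p)"
      using nonneg[of p q] nonneg[of q p] assms by (intro mult_nonneg_nonneg) simp_all
    with factor show ?thesis by linarith
  qed
  show "p = a \<and> q = b \<or> p = b \<and> q = a" if "a * b * (p\<^sup>2 + q\<^sup>2) = (a\<^sup>2 + b\<^sup>2) * (p * q)"
  proof -
    have "b * p = a * q \<or> b * q = a * p"
      using factor that by simp
    then show ?thesis
      using extremal[of p q] extremal[of q p] assms by auto
  qed
qed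

text \<open>Over the common denominator \<open>(a + b) * (x * y)\<close> the numerators are the two
  sides of \<open>weighted_sum_squares_le\<close>, taken at the square roots of \<open>a\<close>,
  \<open>b\<close>, \<open>x\<close> and \<open>y\<close>.\<close>

lemma inverse_sqrt_mult_ge:
  fixes a b x y :: real
  assumes "0 < a" "a \<le> x" "x \<le> b" "a \<le> y" "y \<le> b"
  shows "sqrt (a * b) / (a + b) * (1 / x + 1 / y) \<le> 1 / sqrt (x * y)"
    and "sqrt (a * b) / (a + b) * (1 / x + 1 / y) = 1 / sqrt (x * y) \<Longrightarrow>
      x = a \<and> y = b \<or> x = b \<and> y = a"
proof -
  have pos: "0 < x" "0 < y" "0 < b" "0 < sqrt x" "0 < sqrt y" "0 < a + b"
    using assms by auto
  have sq: "(sqrt a)\<^sup>2 = a" "(sqrt b)\<^sup>2 = b" "(sqrt x)\<^sup>2 = x" "(sqrt y)\<^sup>2 = y"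
    using pos assms by auto
  have hyps: "0 < sqrt a" "sqrt a \<le> sqrt x" "sqrt x \<le> sqrt b" "sqrt a \<le> sqrt y" "sqrt y \<le> sqrt b"
    using assms by auto
  have L: "sqrt (a * b) / (a + b) * (1 / x + 1 / y) =
      sqrt a * sqrt b * (x + y) / ((a + b) * (x * y))"
    using pos by (simp add: real_sqrt_mult field_simps)
  have "1 / sqrt (x * y) = sqrt (x * y) / (x * y)"
    using pos real_sqrt_mult_self[of "x * y"] by (simp add: field_simps)
  then have R: "1 / sqrt (x * y) = (a + b) * (sqrt x * sqrt y) / ((a + b) * (x * y))"
    using pos by (simp add: real_sqrt_mult)
  have den: "0 < (a + b) * (x * y)"
    using pos by simp
  show "sqrt (a * b) / (a + b) * (1 / x + 1 / y) \<le> 1 / sqrt (x * y)"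
    unfolding L R using weighted_sum_squares_le(1)[OF hyps] den
    by (intro divide_right_mono) (auto simp: sq)
  show "x = a \<and> y = b \<or> x = b \<and> y = a"
    if "sqrt (a * b) / (a + b) * (1 / x + 1 / y) = 1 / sqrt (x * y)"
  proof -
    have "sqrt a * sqrt b * (x + y) = (a + b) * (sqrt x * sqrt y)"
      using that den unfolding L R by (metis divide_cancel_right less_irrefl)
    then show ?thesis
      using weighted_sum_squares_le(2)[OF hyps] by (simp add: sq)
  qed
qed

context graph
begin

text \<open>Distinct endpoints let a sum or product over the set \<open>e\<close> split into exactly
  two terms.\<close>

lemma uedgesE:
  assumes "e \<in> uedges G"
  obtains u v where "e = {u, v}" "u \<rightarrow>\<^bsub>G\<^esub> v" "u \<noteq> v" "u \<in> verts G" "v \<in> verts G"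
proof -
  from assms obtain u v where "e = {u, v}" "u \<rightarrow>\<^bsub>G\<^esub> v"
    by (auto simp: uedges_def)
  moreover from this have "u \<noteq> v" "u \<in> verts G" "v \<in> verts G"
    using adj_not_same adj_in_verts by auto
  ultimately show thesis by (rule that)
qed

lemma finite_uedges: "finite (uedges G)"
  by (rule finite_subset[of _ "Pow (verts G)"]) (auto elim!: uedgesE)

lemma min_degree_le: "v \<in> verts G \<Longrightarrow> min_degree G \<le> vdegree G v"
  by (simp add: min_degree_def)

lemma le_max_degree: "v \<in> verts G \<Longrightarrow> vdegree G v \<le> max_degree G"
  by (simp add: max_degree_def)

lemma card_verts_eq_sum_uedges:
  assumes "0 < min_degree G"
  shows "real (card (verts G)) = (\<Sum>e\<in>uedges G. \<Sum>v\<in>e. 1 / real (vdegree G v))"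
proof -
  have "real (card (verts G)) = (\<Sum>v\<in>verts G. 1)"
    by simp
  also have "\<dots> = (\<Sum>v\<in>verts G. \<Sum>e | e \<in> uedges G \<and> v \<in> e. 1 / real (vdegree G v))"
  proof (rule sum.cong)
    fix v assume "v \<in> verts G"
    \<comment> \<open>The inner sum has \<open>vdegree G v\<close> equal terms. At an isolated
      vertex it would be empty, giving 0 instead of 1; positive minimum degree excludes
      this.\<close>
    then have "vdegree G v \<noteq> 0"
      using min_degree_le[of v] assms by simp
    then show "1 = (\<Sum>e | e \<in> uedges G \<and> v \<in> e. 1 / real (vdegree G v))"
      using vdegree_eq_card_uedges[of v] by simp
  qed simp
  also have "\<dots> = (\<Sum>e\<in>uedges G. \<Sum>v | v \<in> verts G \<and> v \<in> e. 1 / real (vdegree G v))"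
    by (rule sum.swap_restrict) (simp_all add: finite_uedges)
  also have "\<dots> = (\<Sum>e\<in>uedges G. \<Sum>v\<in>e. 1 / real (vdegree G v))"
    by (intro sum.cong refl) (auto elim!: uedgesE)
  finally show ?thesis .
qed

lemma edge_weight_ge:
  assumes "0 < min_degree G" "e \<in> uedges G"
  defines "a \<equiv> real (min_degree G)" and "b \<equiv> real (max_degree G)"
  shows "sqrt (a * b) / (a + b) * (\<Sum>v\<in>e. 1 / real (vdegree G v)) \<le>
    1 / sqrt (\<Prod>v\<in>e. real (vdegree G v))"
  using assms(2)
proof (cases rule: uedgesE)
  case (1 u v)
  then show ?thesis
    using inverse_sqrt_mult_ge(1)[of a "real (vdegree G u)" b "real (vdegree G v)"] assms(1)
      min_degree_le[of u] min_degree_le[of v] le_max_degree[of u] le_max_degree[of v]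
    by (simp add: a_def b_def)
qed

lemma randic_index_ge:
  assumes "0 < min_degree G"
  defines "a \<equiv> real (min_degree G)" and "b \<equiv> real (max_degree G)"
  shows "sqrt (a * b) / (a + b) * real (card (verts G)) \<le> randic_index G"
  unfolding card_verts_eq_sum_uedges[OF assms(1)] randic_index_def a_def b_def
  by (subst sum_distrib_left, intro sum_mono edge_weight_ge assms(1))

lemma biregular_if_randic_index_eq:
  assumes "0 < min_degree G" "min_degree G < max_degree G"
  defines "a \<equiv> real (min_degree G)" and "b \<equiv> real (max_degree G)"
  assumes eq: "randic_index G = sqrt (a * b) / (a + b) * real (card (verts G))"
  shows "biregular (min_degree G) (max_degree G) G"
proof -
  let ?d = "min_degree G" and ?D = "max_degree G"
  let ?l = "\<lambda>e. sqrt (a * b) / (a + b) * (\<Sum>v\<in>e. 1 / real (vdegree G v))"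
  let ?r = "\<lambda>e. 1 / sqrt (\<Prod>v\<in>e. real (vdegree G v))"
  have sums: "sum ?l (uedges G) = sum ?r (uedges G)"
    using eq unfolding card_verts_eq_sum_uedges[OF assms(1)] randic_index_def
    by (subst sum_distrib_left[symmetric]) simp
  \<comment> \<open>Termwise inequalities between finite sums with the same total must all be
    equalities.\<close>
  have tight: "?l e = ?r e" if "e \<in> uedges G" for e
    using sum_mono_inv[OF sums _ that finite_uedges] edge_weight_ge[OF assms(1)]
    by (simp add: a_def b_def)
  have ends: "vdegree G u = ?d \<and> vdegree G v = ?D \<or> vdegree G u = ?D \<and> vdegree G v = ?d"
    if "u \<rightarrow>\<^bsub>G\<^esub> v" for u v
  proof -
    have "{u, v} \<in> uedges G" "u \<noteq> v" and verts: "u \<in> verts G" "v \<in> verts G"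
      using that adj_not_same adj_in_verts by (auto simp: uedges_def)
    then have "sqrt (a * b) / (a + b) * (1 / real (vdegree G u) + 1 / real (vdegree G v)) =
        1 / sqrt (real (vdegree G u) * real (vdegree G v))"
      using tight[of "{u, v}"] by simp
    then show ?thesis
      using inverse_sqrt_mult_ge(2)[of a "real (vdegree G u)" b "real (vdegree G v)"] assms(1) verts
        min_degree_le[of u] min_degree_le[of v] le_max_degree[of u] le_max_degree[of v]
      by (simp add: a_def b_def)
  qed
  \<comment> \<open>As the minimum degree is positive, every vertex lies on an edge, and
    \<open>ends\<close> determines the degrees there.\<close>
  have degrees: "vdegree G v = ?d \<or> vdegree G v = ?D" if "v \<in> verts G" for v
  proof -
    have "card {e \<in> uedges G. v \<in> e} \<noteq> 0"
      using min_degree_le[OF that] assms(1) vdegree_eq_card_uedges[of v] by simp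
    then obtain e where "e \<in> uedges G" "v \<in> e"
      by (auto simp: card_eq_0_iff)
    then show ?thesis
      using ends by (auto simp: uedges_def)
  qed
  \<comment> \<open>The two degree classes serve as the parts: they are disjoint because the minimum
    degree is strictly below the maximum, and by \<open>ends\<close> every edge crosses between
    them.\<close>
  let ?A = "{v \<in> verts G. vdegree G v = ?d}" and ?B = "{v \<in> verts G. vdegree G v = ?D}"
  have "bipartition G ?A ?B"
    unfolding bipartition_def
  proof (intro conjI allI impI)
    show "?A \<union> ?B = verts G"
      using degrees by blast
    show "?A \<inter> ?B = {}"
      using assms(2) by auto
    show "u \<in> ?A \<and> v \<in> ?B \<or> u \<in> ?B \<and> v \<in> ?A" if "u \<rightarrow>\<^bsub>G\<^esub> v" for u v
      using ends[OF that] adj_in_verts[OF that] by blast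
  qed
  then show ?thesis
    unfolding biregular_def by blast
qed

end

theorem theorem2p1:
  fixes G :: "('a, 'b) pre_digraph" and d D n :: nat
  assumes "0 < d" and "d < D"
    and "graph G" and "verts G \<noteq> {}" and "card (verts G) = n"
    and "min_degree G = d" and "max_degree G = D"
  shows "randic_index G \<ge> sqrt (real d * real D) / (real d + real D) * real n \<and>
    (randic_index G = sqrt (real d * real D) / (real d + real D) * real n \<longrightarrow> biregular d D G)"
  using graph.randic_index_ge[of G] graph.biregular_if_randic_index_eq[of G] assms by auto

end
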